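(* Let $K$ be a field such that every quadratic equation $x^2+ax+b=0$ with $a,b\in K$ has a root in $K$. Let $G$ be a group and let $f:G\to K$ be a function. Then $f$ is the character of a representation $G\to SL(2,K)$ if and only if for every subgroup $H\le G$ generated by two elements, the restriction $f|_H$ is the character of a representation $H\to SL(2,K)$.
   Context: The character of a representation (group homomorphism) $\rho:G\to SL(2,K)$ is the function $G\to K$, $g\mapsto \operatorname{tr}\rho(g)$. The group $G$ is arbitrary (not assumed finitely generated). *)

theory Defs
  imports "HOL-Analysis.Determinants" "HOL-Algebra.Generated_Groups"
begin

definition special_linear :: "('k::comm_ring_1 ^ 'n ^ 'n) monoid" where
  "special_linear = \<lparr>carrier = {A. det A = 1}, mult = (**), one = mat 1\<rparr>"

lemma group_special_linear: "group (special_linear :: ('k::field ^ 'n ^ 'n) monoid)"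
proof (rule groupI)
  fix A :: "'k ^ 'n ^ 'n"
  assume "A \<in> carrier special_linear"
  then have A: "det A = 1" by (simp add: special_linear_def)
  then obtain B where B: "B ** A = mat 1"
    using invertible_det_nz[of A] by (auto simp: invertible_def)
  with A have "det B = 1" by (metis det_I det_mul mult.right_neutral)
  with B show "\<exists>B\<in>carrier special_linear. B \<otimes>\<^bsub>special_linear\<^esub> A = \<one>\<^bsub>special_linear\<^esub>"
    by (auto simp: special_linear_def)
qed (auto simp: special_linear_def det_mul matrix_mul_assoc)

text \<open>Only the values of \<^term>\<open>f\<close> on \<^term>\<open>carrier G\<close> matter.\<close>

definition is_SL2_character :: "('a, 'b) monoid_scheme \<Rightarrow> ('a \<Rightarrow> 'k::field) \<Rightarrow> bool" where
  "is_SL2_character G f \<longleftrightarrow>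
    (\<exists>\<rho> \<in> hom G (special_linear :: ('k ^ 2 ^ 2) monoid). \<forall>g \<in> carrier G. f g = trace (\<rho> g))"

end

theory Submission
  imports Defs
begin

text \<open>
  In \<open>SL\<^sub>2\<close> the identity \<open>h + h\<inverse> = tr h\<close> (Cayley--Hamilton) shows that every character \<open>f\<close>
  satisfies \<open>f \<one> = 2\<close> and the trace identity \<open>f (g h) + f (g h\<inverse>) = f g * f h\<close>. The identity
  involves only two elements at a time, so it holds on all of \<open>G\<close> as soon as \<open>f\<close> restricts to a
  character on every two-generator subgroup. It remains to build a representation from a function
  \<open>f\<close> that satisfies it. The construction depends on the values of \<open>f\<close> at
  commutators.

  \<^bold>\<open>Irreducible case:\<close> \<open>f (b a b\<inverse> a\<inverse>) \<noteq> 2\<close> for some \<open>a, b\<close>. Take a representation \<open>\<sigma>\<close> of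
  the subgroup generated by \<open>a\<close> and \<open>b\<close> with character \<open>f\<close>, and put \<open>A = \<sigma> a\<close>, \<open>B = \<sigma> b\<close>. The
  matrices \<open>1, A, B, A B\<close> form a basis of the \<open>2 \<times> 2\<close> matrices (\<open>matrix_2_span\<close>), so for every
  \<open>u \<in> G\<close> there is a unique matrix \<open>\<rho> u\<close> with \<open>tr (\<rho> u \<sigma> w) = f (w u)\<close> for
  \<open>w \<in> {1, a, b, a b}\<close>. The key point (\<open>translate_in_span\<close>) is that the coefficients of \<open>\<rho> u\<close> in this
  basis also express the translate \<open>x \<mapsto> f (x u)\<close> as a combination of the translates of \<open>f\<close> by
  \<open>1, a, b, a b\<close>, as a function on the whole of \<open>G\<close>. Consequently \<open>tr (\<rho> u \<rho> v \<sigma> w) = f (u v w)\<close>,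
  and nondegeneracy of the trace form makes \<open>\<rho>\<close> a homomorphism.

  The key point is a computation in the group algebra of \<open>G\<close> modulo the radical of the form
  \<open>(u, v) \<mapsto> f (u v)\<close>, where \<open>u + u\<^sup>* = f u\<close> for the involution extending inversion. An element \<open>c\<close>
  orthogonal to \<open>1, a, b, a b\<close> satisfies \<open>c s = s\<^sup>* c\<close> for these \<open>s\<close>. Comparing the two ways to move
  \<open>a b\<close> past \<open>c\<close> shows that \<open>k c = c\<close> for a commutator \<open>k\<close> of \<open>a\<close> and \<open>b\<close>, hence
  \<open>f k c = (k + k\<inverse>) c = 2 c\<close> and \<open>c = 0\<close> (\<open>vanishing_of_orthogonal\<close>).

  \<^bold>\<open>Reducible case:\<close> all commutators have trace \<open>2\<close>. Fricke's formula (\<open>f_commutator\<close>) shows that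
  then \<open>f (k x) = f x\<close> for every commutator \<open>k\<close> and all \<open>x\<close> (\<open>translate_sign\<close>), so that \<open>f\<close> factors
  through the abelianization, and a homomorphism \<open>\<psi>\<close> to the units of \<open>K\<close> with
  \<open>f = \<psi> + \<psi>\<inverse>\<close> can be written down explicitly. This case alone uses roots of quadratic equations.
\<close>

section \<open>Functions satisfying the trace identity\<close>

text \<open>Functions on a group that satisfy the identities valid for all characters of representations
  in \<open>SL\<^sub>2\<close>. Values outside the carrier are irrelevant.\<close>

locale trace_function = group G for G (structure) +
  fixes f :: "'a \<Rightarrow> 'k::field"
  assumes f_one: "f \<one> = 2"
    and f_mult_inv: "\<lbrakk>g \<in> carrier G; h \<in> carrier G\<rbrakk> \<Longrightarrow> f (g \<otimes> h) + f (g \<otimes> inv h) = f g * f h"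
begin

lemma inv_cancel [simp]:
  assumes "x \<in> carrier G" "y \<in> carrier G"
  shows "inv x \<otimes> (x \<otimes> y) = y" "x \<otimes> (inv x \<otimes> y) = y"
  using assms by (simp_all flip: m_assoc)

lemma f_inv: "g \<in> carrier G \<Longrightarrow> f (inv g) = f g"
  using f_mult_inv[of \<one> g] f_one by simp

lemma f_commute:
  assumes "g \<in> carrier G" "h \<in> carrier G"
  shows "f (g \<otimes> h) = f (h \<otimes> g)"
proof -
  have "f (g \<otimes> inv h) = f (h \<otimes> inv g)"
    using assms f_inv[of "g \<otimes> inv h"] by (simp add: inv_mult_group)
  then show ?thesis
    using assms f_mult_inv[of g h] f_mult_inv[of h g]
    by (metis add_right_cancel mult.commute)
qed

lemma f_inv_mult:
  assumes "g \<in> carrier G" "h \<in> carrier G"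
  shows "f (g \<otimes> h) + f (inv g \<otimes> h) = f g * f h"
  using assms f_mult_inv[of h g] f_commute[of h g] f_commute[of h "inv g"]
  by (simp add: mult.commute)

text \<open>The trace identity with the factor \<open>g\<close> in the middle of a product. It is linear in \<open>y\<close>,
  so it passes to linear combinations of the translates \<open>x \<mapsto> f (x y)\<close>.\<close>

lemma f_mult_inv_middle:
  assumes "x \<in> carrier G" "g \<in> carrier G" "y \<in> carrier G"
  shows "f (x \<otimes> g \<otimes> y) + f (x \<otimes> inv g \<otimes> y) = f g * f (x \<otimes> y)"
  using assms f_mult_inv[of "y \<otimes> x" g] f_commute[of y "x \<otimes> g"] f_commute[of y "x \<otimes> inv g"]
    f_commute[of y x]
  by (simp add: m_assoc mult.commute)

text \<open>Fricke's formula for the trace of a commutator.\<close>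

lemma f_commutator:
  assumes "g \<in> carrier G" "h \<in> carrier G"
  shows "f (g \<otimes> h \<otimes> inv g \<otimes> inv h)
    = f g ^ 2 + f h ^ 2 + f (g \<otimes> h) ^ 2 - f g * f h * f (g \<otimes> h) - 2"
proof -
  have conj: "f (h \<otimes> g \<otimes> inv h) = f g"
    using assms f_commute[of "h \<otimes> g" "inv h"] by (simp add: m_assoc)
  have 1: "f (g \<otimes> (h \<otimes> g \<otimes> inv h)) + f (g \<otimes> h \<otimes> inv g \<otimes> inv h) = f g * f g"
    using assms f_mult_inv[of g "h \<otimes> g \<otimes> inv h"] conj
    by (simp add: m_assoc inv_mult_group)
  have "f (g \<otimes> h \<otimes> (h \<otimes> inv g)) = f (h \<otimes> h)"
    using assms f_commute[of "g \<otimes> (h \<otimes> h)" "inv g"] by (simp add: m_assoc)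
  then have 2: "f (g \<otimes> (h \<otimes> g \<otimes> inv h)) + f (h \<otimes> h) = f (g \<otimes> h) * f (g \<otimes> inv h)"
    using assms f_mult_inv[of "g \<otimes> h" "g \<otimes> inv h"]
    by (simp add: m_assoc inv_mult_group)
  have 3: "f (h \<otimes> h) + 2 = f h * f h"
    using assms f_mult_inv[of h h] f_one by simp
  have 4: "f (g \<otimes> h) + f (g \<otimes> inv h) = f g * f h"
    using assms by (rule f_mult_inv)
  show ?thesis using 1 2 3 4 by algebra
qed

text \<open>This expresses the identity \<open>u s - s\<^sup>* u = f (s u) - f u s\<^sup>*\<close> of the quotient algebra with
  involution, which is again linear in \<open>u\<close>: if \<open>u\<close> is orthogonal to \<open>1\<close> and to \<open>s\<close>, then
  \<open>u s = s\<^sup>* u\<close>.\<close>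

lemma f_translate_twist:
  assumes "s \<in> carrier G" "x \<in> carrier G" "u \<in> carrier G"
  shows "f (s \<otimes> x \<otimes> u) - f (x \<otimes> inv s \<otimes> u) = f (s \<otimes> u) * f x - f u * f (x \<otimes> inv s)"
proof -
  have "f (u \<otimes> s \<otimes> x) + f (u \<otimes> s \<otimes> inv x) = f (u \<otimes> s) * f x"
    using assms by (intro f_mult_inv) auto
  moreover have "f (u \<otimes> (x \<otimes> inv s)) + f (u \<otimes> s \<otimes> inv x) = f u * f (x \<otimes> inv s)"
    using assms f_mult_inv[of u "x \<otimes> inv s"] by (simp add: m_assoc inv_mult_group)
  moreover have "f (u \<otimes> s \<otimes> x) = f (s \<otimes> x \<otimes> u)" "f (u \<otimes> (x \<otimes> inv s)) = f (x \<otimes> inv s \<otimes> u)"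
    "f (u \<otimes> s) = f (s \<otimes> u)"
    using assms f_commute[of u "s \<otimes> x"] f_commute[of u "x \<otimes> inv s"] f_commute[of u s]
    by (simp_all add: m_assoc)
  ultimately show ?thesis by algebra
qed

text \<open>Here \<open>F\<close> stands for \<open>x \<mapsto> f (x c)\<close> with \<open>c\<close> in the group algebra; the two hypotheses on \<open>F\<close>
  are the linear identities \<open>f_mult_inv_middle\<close> and \<open>f_translate_twist\<close>.\<close>

lemma vanishing_of_orthogonal:
  fixes F :: "'a \<Rightarrow> 'k"
  assumes ab: "a \<in> carrier G" "b \<in> carrier G"
    and irred: "f (b \<otimes> a \<otimes> inv b \<otimes> inv a) \<noteq> 2"
    and F_mult_inv: "\<And>x g. \<lbrakk>x \<in> carrier G; g \<in> carrier G\<rbrakk> \<Longrightarrow> F (x \<otimes> g) + F (x \<otimes> inv g) = f g * F x"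
    and F_twist: "\<And>s x. \<lbrakk>s \<in> carrier G; x \<in> carrier G\<rbrakk> \<Longrightarrow>
      F (s \<otimes> x) - F (x \<otimes> inv s) = F s * f x - F \<one> * f (x \<otimes> inv s)"
    and F_zero: "F \<one> = 0" "F a = 0" "F b = 0" "F (a \<otimes> b) = 0"
    and x: "x \<in> carrier G"
  shows "F x = 0"
proof -
  define k where "k = b \<otimes> a \<otimes> inv b \<otimes> inv a"
  have k: "k \<in> carrier G" using ab by (simp add: k_def)
  have twist: "F (s \<otimes> y) = F (y \<otimes> inv s)"
    if "s \<in> {a, b, a \<otimes> b}" "y \<in> carrier G" for s y
    using F_twist[of s y] that ab F_zero by auto
  have fixed: "F (y \<otimes> k) = F y" if y: "y \<in> carrier G" for y
  proof -
    define z where "z = y \<otimes> b \<otimes> a"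
    have z: "z \<in> carrier G" using ab y by (simp add: z_def)
    \<comment> \<open>Moving \<open>a b\<close> to the right end in one step or letter by letter inverts both letters, in
      the first case also reversing their order.\<close>
    have "F (z \<otimes> inv b \<otimes> inv a) = F (a \<otimes> b \<otimes> z)"
      using twist[of "a \<otimes> b" z] ab z by (simp add: inv_mult_group m_assoc)
    also have "\<dots> = F (z \<otimes> inv a \<otimes> inv b)"
      using twist[of a "b \<otimes> z"] twist[of b "z \<otimes> inv a"] ab z by (simp add: m_assoc)
    finally show ?thesis using ab y by (simp add: z_def k_def m_assoc)
  qed
  have "F (x \<otimes> inv k) = F x"
    using fixed[of "x \<otimes> inv k"] k x by (simp add: m_assoc)
  then have "(f k - 2) * F x = 0"
    using F_mult_inv[OF x k] fixed[OF x] by (simp add: algebra_simps)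
  then show ?thesis using irred by (simp add: k_def)
qed

text \<open>If \<open>f (x u)\<close> is a given combination of \<open>f x\<close>, \<open>f (x a)\<close>, \<open>f (x b)\<close> and \<open>f (x a b)\<close> for the four
  elements \<open>x = 1, a, b, a b\<close>, then it is the same combination for every \<open>x\<close>.\<close>

lemma translate_in_span:
  assumes ab: "a \<in> carrier G" "b \<in> carrier G"
    and irred: "f (b \<otimes> a \<otimes> inv b \<otimes> inv a) \<noteq> 2"
    and u: "u \<in> carrier G"
    and on_basis: "\<And>w. w \<in> {\<one>, a, b, a \<otimes> b} \<Longrightarrow>
      f (w \<otimes> u) = c\<^sub>1 * f w + c\<^sub>2 * f (w \<otimes> a) + c\<^sub>3 * f (w \<otimes> b) + c\<^sub>4 * f (w \<otimes> (a \<otimes> b))"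
    and x: "x \<in> carrier G"
  shows "f (x \<otimes> u) = c\<^sub>1 * f x + c\<^sub>2 * f (x \<otimes> a) + c\<^sub>3 * f (x \<otimes> b) + c\<^sub>4 * f (x \<otimes> (a \<otimes> b))"
proof -
  define F where "F = (\<lambda>x. f (x \<otimes> u)
    - (c\<^sub>1 * f (x \<otimes> \<one>) + c\<^sub>2 * f (x \<otimes> a) + c\<^sub>3 * f (x \<otimes> b) + c\<^sub>4 * f (x \<otimes> (a \<otimes> b))))"
  have "F x = 0"
  proof (rule vanishing_of_orthogonal[OF ab irred _ _ _ _ _ _ x])
    fix x g assume "x \<in> carrier G" "g \<in> carrier G"
    then show "F (x \<otimes> g) + F (x \<otimes> inv g) = f g * F x"
      using f_mult_inv_middle[of x g u] f_mult_inv_middle[of x g \<one>] f_mult_inv_middle[of x g a]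
        f_mult_inv_middle[of x g b] f_mult_inv_middle[of x g "a \<otimes> b"] ab u
      unfolding F_def by (simp del: r_one) algebra
  next
    fix s x assume "s \<in> carrier G" "x \<in> carrier G"
    then show "F (s \<otimes> x) - F (x \<otimes> inv s) = F s * f x - F \<one> * f (x \<otimes> inv s)"
      using f_translate_twist[of s x u] f_translate_twist[of s x \<one>] f_translate_twist[of s x a]
        f_translate_twist[of s x b] f_translate_twist[of s x "a \<otimes> b"] ab u
      unfolding F_def by (simp del: r_one) algebra
  qed (use on_basis[of \<one>] on_basis[of a] on_basis[of b] on_basis[of "a \<otimes> b"] ab u in
      \<open>simp_all add: F_def\<close>)
  then show ?thesis using x by (simp add: F_def)
qed

end

section \<open>Two-by-two matrices\<close>

lemmas matrix_2_simps = vec_eq_iff forall_2 sum_2 trace_def det_2 matrix_matrix_mult_def mat_def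

lemma trace_mat_mult: "trace (mat c ** A) = c * trace (A :: 'k::comm_ring_1 ^ 2 ^ 2)"
  by (simp add: matrix_2_simps algebra_simps)

lemma inverse_SL2:
  fixes A A' :: "'k::field ^ 2 ^ 2"
  assumes "det A = 1" "A ** A' = mat 1"
  shows "A' = mat (trace A) - A"
proof -
  have "(mat (trace A) - A) ** A = mat (det A)"
    by (simp add: matrix_2_simps algebra_simps)
  then have "A' = (mat (trace A) - A) ** A ** A'" using assms(1) by simp
  then show ?thesis using assms(2) by (simp flip: matrix_mul_assoc)
qed

lemma trace_add_mult:
  fixes A B :: "'k::comm_ring_1 ^ 'n ^ 'm"
  shows "trace ((A + B) ** C) = trace (A ** C) + trace (B ** C)"
  by (simp add: trace_def matrix_matrix_mult_def sum.distrib algebra_simps)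

text \<open>The discriminant \<open>tr ((A B - B A) A B) = - det (A B - B A)\<close> decides below whether
  \<open>1, A, B, A B\<close> is a basis. For matrices of determinant \<open>1\<close> it is nonzero exactly when the
  commutator has trace different from \<open>2\<close>.\<close>

lemma trace_commutator_SL2:
  fixes A B :: "'k::field ^ 2 ^ 2"
  assumes "det A = 1" "det B = 1" "A ** A' = mat 1" "B ** B' = mat 1"
  shows "trace (B ** A ** B' ** A') = 2 + trace ((A ** B - B ** A) ** (A ** B))"
proof -
  have "trace (B ** A ** (mat (trace B) - B) ** (mat (trace A) - A))
    = 2 * det A * det B + trace ((A ** B - B ** A) ** (A ** B))"
    by (simp add: matrix_2_simps; algebra)
  then show ?thesis using assms inverse_SL2[of A A'] inverse_SL2[of B B'] by simp
qed

lemma trace_combination_mult: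
  fixes A B Y :: "'k::comm_ring_1 ^ 2 ^ 2"
  shows "trace ((mat c\<^sub>1 + mat c\<^sub>2 ** A + mat c\<^sub>3 ** B + mat c\<^sub>4 ** (A ** B)) ** Y)
    = c\<^sub>1 * trace Y + c\<^sub>2 * trace (A ** Y) + c\<^sub>3 * trace (B ** Y) + c\<^sub>4 * trace (A ** B ** Y)"
  by (simp add: matrix_2_simps algebra_simps)

text \<open>With \<open>N = A B - B A\<close>, the basis dual to \<open>1, A, B, A B\<close> for the trace form is, up to the
  factor \<open>tr (N A B)\<close>, formed by \<open>N B (tr A - A)\<close>, \<open>- N B\<close>, \<open>- A N\<close> and \<open>N\<close>. For the last
  three this holds because the commutator of two matrices is orthogonal to \<open>1\<close> and to both of them, and
  \<open>N B = - [B, A B]\<close>, \<open>A N = [A, A B]\<close>. The first is \<open>N B\<close> times the adjugate of \<open>A\<close>.\<close>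

lemma trace_dual_basis:
  fixes A B :: "'k::field ^ 2 ^ 2"
  assumes "trace ((A ** B - B ** A) ** (A ** B)) \<noteq> 0"
  obtains M where "trace M = t\<^sub>1" "trace (M ** A) = t\<^sub>2" "trace (M ** B) = t\<^sub>3" "trace (M ** (A ** B)) = t\<^sub>4"
proof -
  define N where "N = A ** B - B ** A"
  define d where "d = trace (N ** (A ** B))"
  define M where "M = mat (t\<^sub>1 / d) ** (N ** B ** (mat (trace A) - A)) - mat (t\<^sub>2 / d) ** (N ** B)
     - mat (t\<^sub>3 / d) ** (A ** N) + mat (t\<^sub>4 / d) ** N"
  have d: "d \<noteq> 0" using assms by (simp add: d_def N_def)
  have tr: "trace (M ** Y) = t\<^sub>1 / d * trace (N ** B ** (mat (trace A) - A) ** Y)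
     - t\<^sub>2 / d * trace (N ** B ** Y) - t\<^sub>3 / d * trace (A ** N ** Y) + t\<^sub>4 / d * trace (N ** Y)" for Y
    by (simp add: M_def matrix_2_simps algebra_simps)
  have 1: "trace (N ** B ** (mat (trace A) - A) ** mat 1) = d"
    "trace (N ** B ** (mat (trace A) - A) ** A) = 0"
    "trace (N ** B ** (mat (trace A) - A) ** B) = 0"
    "trace (N ** B ** (mat (trace A) - A) ** (A ** B)) = 0"
    unfolding N_def d_def by (simp_all add: matrix_2_simps; algebra)+
  have 2: "trace (N ** B ** mat 1) = 0"
    "trace (N ** B ** A) = - d"
    "trace (N ** B ** B) = 0"
    "trace (N ** B ** (A ** B)) = 0"
    unfolding N_def d_def by (simp_all add: matrix_2_simps; algebra)+
  have 3: "trace (A ** N ** mat 1) = 0"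
    "trace (A ** N ** A) = 0"
    "trace (A ** N ** B) = - d"
    "trace (A ** N ** (A ** B)) = 0"
    unfolding N_def d_def by (simp_all add: matrix_2_simps; algebra)+
  have 4: "trace (N ** mat 1) = 0"
    "trace (N ** A) = 0"
    "trace (N ** B) = 0"
    unfolding N_def d_def by (simp_all add: matrix_2_simps; algebra)+
  show thesis
    by (rule that[of M])
      (use tr[of "mat 1"] tr[of A] tr[of B] tr[of "A ** B"] 1 2 3 4 d in \<open>simp_all add: d_def[symmetric]\<close>)
qed

lemma matrix_2_span:
  fixes A B M :: "'k::field ^ 2 ^ 2"
  assumes "trace ((A ** B - B ** A) ** (A ** B)) \<noteq> 0"
  obtains c\<^sub>1 c\<^sub>2 c\<^sub>3 c\<^sub>4 where "M = mat c\<^sub>1 + mat c\<^sub>2 ** A + mat c\<^sub>3 ** B + mat c\<^sub>4 ** (A ** B)"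
proof -
  define N where "N = A ** B - B ** A"
  define d where "d = trace (N ** (A ** B))"
  \<comment> \<open>The coefficients are the traces of \<open>M\<close> against the dual basis, multiplied by \<open>d\<close>.\<close>
  define e1 where "e1 = trace (M ** (N ** B ** (mat (trace A) - A)))"
  define e2 where "e2 = - trace (M ** (N ** B))"
  define e3 where "e3 = - trace (M ** (A ** N))"
  define e4 where "e4 = trace (M ** N)"
  have d: "d \<noteq> 0" using assms by (simp add: d_def N_def)
  have *: "d * M $ i $ j = e1 * mat 1 $ i $ j + e2 * A $ i $ j + e3 * B $ i $ j
      + e4 * (A ** B) $ i $ j" for i j
  proof -
    have "\<forall>i j. d * M $ i $ j = e1 * mat 1 $ i $ j + e2 * A $ i $ j + e3 * B $ i $ j
      + e4 * (A ** B) $ i $ j"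
      unfolding e1_def e2_def e3_def e4_def d_def N_def forall_2
      by (intro conjI; simp add: matrix_2_simps; algebra)
    then show ?thesis by blast
  qed
  have "M = mat (e1/d) + mat (e2/d) ** A + mat (e3/d) ** B + mat (e4/d) ** (A ** B)"
    using *[of 1 1] *[of 1 2] *[of 2 1] *[of 2 2] d
    by (simp add: matrix_2_simps field_simps)
  then show thesis by (rule that)
qed

text \<open>The trace form is nondegenerate: testing against matrix units recovers the entries.\<close>

lemma matrix_2_eq_if_traces_eq:
  fixes M N :: "'k::comm_ring_1 ^ 2 ^ 2"
  assumes "\<And>Y. trace (M ** Y) = trace (N ** Y)"
  shows "M = N"
proof -
  have "M $ i $ j = N $ i $ j" for i j
    using assms[of "\<chi> k l. if k = j then if l = i then 1 else 0 else 0"]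
    by (simp add: trace_def matrix_matrix_mult_def if_distrib[of "(*) _"] if_distrib[of "sum _"] cong: if_cong)
  then show ?thesis by (simp add: vec_eq_iff)
qed

text \<open>If the inverse of \<open>M\<close> equals its adjugate \<open>tr M - M\<close>, then \<open>det M = 1\<close>.\<close>

lemma det_eq_1_if_trace_inverse:
  fixes M M' :: "'k::comm_ring_1 ^ 2 ^ 2"
  assumes "M ** M' = mat 1" "M + M' = mat (trace M)"
  shows "det M = 1"
proof -
  have "M ** (mat (trace M) - M) = mat (det M)"
    by (simp add: matrix_2_simps algebra_simps)
  moreover have "M' = mat (trace M) - M" using assms(2) by (metis add_diff_cancel_left')
  ultimately have "mat (det M) = (mat 1 :: 'k ^ 2 ^ 2)" using assms(1) by simp
  then show ?thesis by (simp add: matrix_2_simps)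
qed

section \<open>The reducible case\<close>

lemma is_SL2_character_diagonal:
  fixes \<psi> f :: "'a \<Rightarrow> 'k::field"
  assumes mult: "\<And>g h. \<lbrakk>g \<in> carrier G; h \<in> carrier G\<rbrakk> \<Longrightarrow> \<psi> (g \<otimes>\<^bsub>G\<^esub> h) = \<psi> g * \<psi> h"
    and nonzero: "\<And>g. g \<in> carrier G \<Longrightarrow> \<psi> g \<noteq> 0"
    and f: "\<And>g. g \<in> carrier G \<Longrightarrow> f g = \<psi> g + inverse (\<psi> g)"
  shows "is_SL2_character G f"
proof -
  define \<rho> :: "'a \<Rightarrow> 'k ^ 2 ^ 2" where
    "\<rho> g = (\<chi> i j. if i = j then (if i = 1 then \<psi> g else inverse (\<psi> g)) else 0)" for g
  have "\<rho> \<in> hom G special_linear"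
    by (rule homI) (use mult nonzero in \<open>simp_all add: \<rho>_def special_linear_def matrix_2_simps\<close>)
  moreover have "f g = trace (\<rho> g)" if "g \<in> carrier G" for g
    using f[OF that] by (simp add: \<rho>_def trace_def sum_2)
  ultimately show ?thesis unfolding is_SL2_character_def by blast
qed

context trace_function
begin

text \<open>When \<open>f g = \<plusminus>2\<close> and the commutator has trace \<open>2\<close>, Fricke's formula reads
  \<open>(f (g h) \<mp> f h)\<^sup>2 = 0\<close>.\<close>

lemma translate_sign:
  assumes "f (g \<otimes> h \<otimes> inv g \<otimes> inv h) = 2" "g \<in> carrier G" "h \<in> carrier G"
  shows "f g = 2 \<Longrightarrow> f (g \<otimes> h) = f h" "f g = - 2 \<Longrightarrow> f (g \<otimes> h) = - f h"
proof -
  have *: "f g ^ 2 + f h ^ 2 + f (g \<otimes> h) ^ 2 - f g * f h * f (g \<otimes> h) - 4 = 0"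
    using f_commutator[of g h] assms by (simp add: algebra_simps)
  have "(f (g \<otimes> h) - f h) ^ 2 = 0" if "f g = 2"
    using * unfolding that by (simp add: power2_eq_square algebra_simps)
  then show "f g = 2 \<Longrightarrow> f (g \<otimes> h) = f h" by simp
  have "(f (g \<otimes> h) + f h) ^ 2 = 0" if "f g = - 2"
    using * unfolding that by (simp add: power2_eq_square algebra_simps)
  then show "f g = - 2 \<Longrightarrow> f (g \<otimes> h) = - f h" by (simp add: add_eq_0_iff2)
qed

lemma is_SL2_character_reducible:
  assumes quadratic_roots: "\<forall>a b :: 'k. \<exists>x. x ^ 2 + a * x + b = 0"
    and red: "\<And>g h. \<lbrakk>g \<in> carrier G; h \<in> carrier G\<rbrakk> \<Longrightarrow> f (g \<otimes> h \<otimes> inv g \<otimes> inv h) = 2"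
  shows "is_SL2_character G f"
proof (cases "\<forall>g \<in> carrier G. f g ^ 2 = 4")
  case True
  \<comment> \<open>Now \<open>f\<close> takes only the values \<open>\<plusminus>2\<close>, and \<open>\<psi>\<close> is the sign. In characteristic \<open>2\<close> both values
    coincide and \<open>\<psi>\<close> is trivial.\<close>
  define \<psi> :: "'a \<Rightarrow> 'k" where "\<psi> g = (if f g = 2 then 1 else - 1)" for g
  have f: "f g = 2 * \<psi> g" if "g \<in> carrier G" for g
  proof -
    have "(f g - 2) * (f g + 2) = 0"
      using True that by (simp add: power2_eq_square algebra_simps)
    then show ?thesis by (auto simp: \<psi>_def add_eq_0_iff2)
  qed
  have translate: "f (g \<otimes> h) = \<psi> g * f h" if "g \<in> carrier G" "h \<in> carrier G" for g h
    using translate_sign[OF red] that f[of g] by (auto simp: \<psi>_def split: if_splits)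
  show ?thesis
  proof (rule is_SL2_character_diagonal)
    fix g h assume gh: "g \<in> carrier G" "h \<in> carrier G"
    then show "\<psi> (g \<otimes> h) = \<psi> g * \<psi> h"
      using translate[OF gh] f[of h] f[of "g \<otimes> h"] by (auto simp: \<psi>_def split: if_splits)
  qed (auto simp: f \<psi>_def)
next
  case False
  then obtain c where c: "c \<in> carrier G" "f c ^ 2 \<noteq> 4" by blast
  obtain l where l: "l ^ 2 + (- f c) * l + 1 = 0" using quadratic_roots by blast
  \<comment> \<open>The eigenvalues \<open>l\<close> and \<open>m\<close> of \<open>c\<close> are distinct because \<open>(l - m)\<^sup>2 = (f c)\<^sup>2 - 4\<close>.\<close>
  define m where "m = f c - l"
  have lm: "l * m = 1" "f c = l + m"
    using l by (simp_all add: m_def power2_eq_square algebra_simps eq_neg_iff_add_eq_0)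
  have "(l - m) ^ 2 \<noteq> 0"
  proof -
    have "(l - m) ^ 2 = f c ^ 2 - 4" using lm by algebra
    then show ?thesis using c(2) by simp
  qed
  then have d: "l - m \<noteq> 0" by simp
  \<comment> \<open>The function \<open>f\<close> factors through the abelianization, as \<open>g h = k h g\<close> for a commutator \<open>k\<close>.\<close>
  have commute: "f (g \<otimes> h \<otimes> x) = f (h \<otimes> g \<otimes> x)"
    if "g \<in> carrier G" "h \<in> carrier G" "x \<in> carrier G" for g h x
  proof -
    have "f (g \<otimes> h \<otimes> inv g \<otimes> inv h \<otimes> (h \<otimes> g \<otimes> x)) = f (h \<otimes> g \<otimes> x)"
      using that by (intro translate_sign(1) red) auto
    then show ?thesis using that by (simp add: m_assoc)
  qed
  \<comment> \<open>Solving \<open>f g = \<psi> g + \<psi> (inv g)\<close> and \<open>f (c g) = l * \<psi> g + m * \<psi> (inv g)\<close> for \<open>\<psi> g\<close>.\<close>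
  define \<psi> where "\<psi> g = (f (c \<otimes> g) - m * f g) / (l - m)" for g
  have mult: "\<psi> (g \<otimes> h) = \<psi> g * \<psi> h" if gh: "g \<in> carrier G" "h \<in> carrier G" for g h
  proof -
    have "f (c \<otimes> g) * f (c \<otimes> h) = f (c \<otimes> (c \<otimes> g \<otimes> h)) + f (g \<otimes> inv h)"
    proof -
      have "f (c \<otimes> g \<otimes> (c \<otimes> h)) = f (c \<otimes> (c \<otimes> g \<otimes> h))"
        using c gh f_commute[of c "g \<otimes> c \<otimes> h"] f_commute[of c "c \<otimes> g \<otimes> h"] commute[of g c "h \<otimes> c"]
        by (simp add: m_assoc)
      moreover have "f (c \<otimes> g \<otimes> inv (c \<otimes> h)) = f (g \<otimes> inv h)"
        using c gh f_commute[of c "g \<otimes> inv h \<otimes> inv c"] by (simp add: m_assoc inv_mult_group)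
      ultimately show ?thesis
        using c gh f_mult_inv[of "c \<otimes> g" "c \<otimes> h"] by simp
    qed
    moreover have "f (c \<otimes> g) * f h = f (c \<otimes> g \<otimes> h) + f (c \<otimes> g \<otimes> inv h)"
      using c gh by (simp add: f_mult_inv)
    moreover have "f g * f (c \<otimes> h) = f (c \<otimes> g \<otimes> h) + f (inv c \<otimes> g \<otimes> inv h)"
      using c gh f_mult_inv[of g "c \<otimes> h"] commute[of g c h] f_commute[of "inv c" "g \<otimes> inv h"]
      by (simp add: m_assoc inv_mult_group)
    moreover have "f g * f h = f (g \<otimes> h) + f (g \<otimes> inv h)"
      using gh by (simp add: f_mult_inv)
    moreover have "f (c \<otimes> (g \<otimes> inv h)) + f (inv c \<otimes> (g \<otimes> inv h)) = f c * f (g \<otimes> inv h)"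
      "f (c \<otimes> (c \<otimes> g \<otimes> h)) + f (inv c \<otimes> (c \<otimes> g \<otimes> h)) = f c * f (c \<otimes> g \<otimes> h)"
      using c gh by (simp_all add: f_inv_mult)
    \<comment> \<open>The terms with \<open>g h\<inverse>\<close> cancel because \<open>1 - m * f c + m\<^sup>2 = 0\<close>.\<close>
    ultimately have "(f (c \<otimes> g) - m * f g) * (f (c \<otimes> h) - m * f h)
      = (l - m) * (f (c \<otimes> (g \<otimes> h)) - m * f (g \<otimes> h))"
      using lm c gh by (simp add: m_assoc) algebra
    then show ?thesis using d by (simp add: \<psi>_def)
  qed
  have one: "\<psi> \<one> = 1" using d c lm f_one by (simp add: \<psi>_def)
  have inverse: "\<psi> g * \<psi> (inv g) = 1" if "g \<in> carrier G" for g
    using mult[of g "inv g"] one that by simp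
  show ?thesis
  proof (rule is_SL2_character_diagonal)
    fix g assume g: "g \<in> carrier G"
    show "\<psi> g \<noteq> 0" using inverse[OF g] by auto
    have "\<psi> g + \<psi> (inv g) = (f (c \<otimes> g) + f (c \<otimes> inv g) - 2 * m * f g) / (l - m)"
      using g by (simp add: \<psi>_def f_inv add_divide_distrib diff_divide_distrib)
    also have "f (c \<otimes> g) + f (c \<otimes> inv g) = (l + m) * f g"
      using c g lm f_mult_inv[of c g] by simp
    also have "((l + m) * f g - 2 * m * f g) / (l - m) = f g"
      using d by (simp add: field_simps)
    finally show "f g = \<psi> g + inverse (\<psi> g)"
      using inverse_unique[OF inverse[OF g]] by simp
  qed (rule mult)
qed

end

section \<open>The irreducible case\<close>

context trace_function
begin

lemma is_SL2_character_irreducible: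
  assumes ab: "a \<in> carrier G" "b \<in> carrier G"
    and irred: "f (b \<otimes> a \<otimes> inv b \<otimes> inv a) \<noteq> 2"
    and char: "is_SL2_character (G\<lparr>carrier := generate G {a, b}\<rparr>) f"
  shows "is_SL2_character G f"
proof -
  define H where "H = generate G {a, b}"
  have H: "subgroup H G" unfolding H_def using ab by (intro generate_is_subgroup) auto
  have HG: "H \<subseteq> carrier G" using H by (rule subgroup.subset)
  have abH: "a \<in> H" "b \<in> H" unfolding H_def by (auto intro: generate.incl)
  note H_closed = subgroup.m_closed[OF H] subgroup.m_inv_closed[OF H] subgroup.one_closed[OF H] abH
  obtain \<sigma> :: "'a \<Rightarrow> 'k ^ 2 ^ 2"
    where hom: "\<sigma> \<in> hom (G\<lparr>carrier := H\<rparr>) special_linear" and f: "\<And>h. h \<in> H \<Longrightarrow> f h = trace (\<sigma> h)"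
    using char unfolding is_SL2_character_def H_def by auto
  have mult: "\<sigma> (g \<otimes> h) = \<sigma> g ** \<sigma> h" if "g \<in> H" "h \<in> H" for g h
    using hom_mult[OF hom, of g h] that by (simp add: special_linear_def)
  have det: "det (\<sigma> h) = 1" if "h \<in> H" for h
    using hom_in_carrier[OF hom, of h] that by (simp add: special_linear_def)
  have one: "\<sigma> \<one> = mat 1"
    using hom_one[OF hom subgroup_imp_group[OF H] group_special_linear]
    by (simp add: special_linear_def)
  have inv: "\<sigma> h ** \<sigma> (inv h) = mat 1" if "h \<in> H" for h
    using mult[of h "inv h"] that one HG H_closed by auto
  define A B where "A = \<sigma> a" and "B = \<sigma> b"
  have "f (b \<otimes> a \<otimes> inv b \<otimes> inv a) = trace (B ** A ** \<sigma> (inv b) ** \<sigma> (inv a))"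
    by (simp add: f mult H_closed A_def B_def)
  also have "\<dots> = 2 + trace ((A ** B - B ** A) ** (A ** B))"
    unfolding A_def B_def by (intro trace_commutator_SL2 det inv abH)
  finally have nz: "trace ((A ** B - B ** A) ** (A ** B)) \<noteq> 0" using irred by auto

  \<comment> \<open>The image of \<open>\<sigma>\<close> spans all matrices, so traces against it determine a matrix.\<close>
  have ext: "M = N" if "\<And>w. w \<in> H \<Longrightarrow> trace (M ** \<sigma> w) = trace (N ** \<sigma> w)" for M N
  proof (rule matrix_2_eq_if_traces_eq)
    fix Y
    obtain c1 c2 c3 c4 where Y: "Y = mat c1 + mat c2 ** A + mat c3 ** B + mat c4 ** (A ** B)"
      using matrix_2_span[OF nz] by blast
    have *: "trace (X ** Y) = c1 * trace (X ** \<sigma> \<one>) + c2 * trace (X ** \<sigma> a) + c3 * trace (X ** \<sigma> b)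
      + c4 * trace (X ** \<sigma> (a \<otimes> b))" for X
      unfolding trace_mul_sym[of X] unfolding Y trace_combination_mult
      by (simp add: one mult abH A_def B_def)
    show "trace (M ** Y) = trace (N ** Y)"
      unfolding * using that H_closed by auto
  qed

  \<comment> \<open>So far \<open>\<rho> u\<close> has the prescribed traces only against the four basis elements.\<close>
  have "\<exists>M. trace M = f u \<and> trace (M ** A) = f (a \<otimes> u) \<and> trace (M ** B) = f (b \<otimes> u)
    \<and> trace (M ** (A ** B)) = f (a \<otimes> b \<otimes> u)" for u
    using trace_dual_basis[OF nz] by metis
  then obtain \<rho> where \<rho>: "\<And>u. trace (\<rho> u) = f u \<and> trace (\<rho> u ** A) = f (a \<otimes> u) \<and>
    trace (\<rho> u ** B) = f (b \<otimes> u) \<and> trace (\<rho> u ** (A ** B)) = f (a \<otimes> b \<otimes> u)"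
    by metis
  \<comment> \<open>The same coefficients expand the matrix \<open>\<rho> u\<close> and the translate of \<open>f\<close> by \<open>u\<close>.\<close>
  have expand: "\<exists>c1 c2 c3 c4.
      (\<forall>Y. trace (\<rho> u ** Y) = c1 * trace Y + c2 * trace (A ** Y)
        + c3 * trace (B ** Y) + c4 * trace (A ** B ** Y)) \<and>
      (\<forall>x \<in> carrier G. f (x \<otimes> u) = c1 * f x + c2 * f (x \<otimes> a)
        + c3 * f (x \<otimes> b) + c4 * f (x \<otimes> (a \<otimes> b)))"
    if u: "u \<in> carrier G" for u
  proof -
    obtain c1 c2 c3 c4 where c: "\<rho> u = mat c1 + mat c2 ** A + mat c3 ** B + mat c4 ** (A ** B)"
      using matrix_2_span[OF nz] by blast
    have tr: "trace (\<rho> u ** Y) = c1 * trace Y + c2 * trace (A ** Y)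
        + c3 * trace (B ** Y) + c4 * trace (A ** B ** Y)" for Y
      unfolding c by (rule trace_combination_mult)
    have fH: "f (w \<otimes> u) = c1 * f w + c2 * f (w \<otimes> a) + c3 * f (w \<otimes> b) + c4 * f (w \<otimes> (a \<otimes> b))"
      if w: "w \<in> {\<one>, a, b, a \<otimes> b}" for w
    proof -
      have wH: "w \<in> H" using w H_closed by auto
      have "f (w \<otimes> u) = trace (\<rho> u ** \<sigma> w)"
        using w u \<rho>[of u] by (auto simp: one mult abH A_def B_def)
      also have "\<dots> = c1 * f w + c2 * f (a \<otimes> w) + c3 * f (b \<otimes> w) + c4 * f (a \<otimes> b \<otimes> w)"
        unfolding tr by (simp add: f mult wH H_closed A_def B_def)
      finally show ?thesis
        using wH HG ab f_commute[of w a] f_commute[of w b] f_commute[of w "a \<otimes> b"] by auto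
    qed
    show ?thesis using tr translate_in_span[OF ab irred u fH] by blast
  qed
  have trace_mult: "trace (\<rho> u ** \<sigma> w) = f (w \<otimes> u)" if u: "u \<in> carrier G" and w: "w \<in> H" for u w
  proof -
    have wG: "w \<in> carrier G" using w HG by auto
    obtain c1 c2 c3 c4 where
      "\<forall>Y. trace (\<rho> u ** Y) = c1 * trace Y + c2 * trace (A ** Y)
        + c3 * trace (B ** Y) + c4 * trace (A ** B ** Y)"
      and "\<forall>x \<in> carrier G. f (x \<otimes> u) = c1 * f x + c2 * f (x \<otimes> a)
        + c3 * f (x \<otimes> b) + c4 * f (x \<otimes> (a \<otimes> b))"
      using expand[OF u] by blast
    then show ?thesis
      using wG ab f_commute[of w a] f_commute[of w b] f_commute[of w "a \<otimes> b"]
      by (simp add: f mult w H_closed A_def B_def)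
  qed
  have \<rho>_mult: "\<rho> (u \<otimes> v) = \<rho> u ** \<rho> v" if u: "u \<in> carrier G" and v: "v \<in> carrier G" for u v
  proof (rule ext)
    fix w assume w: "w \<in> H"
    have wG: "w \<in> carrier G" using w HG by auto
    obtain c1 c2 c3 c4 where
      tr: "\<forall>Y. trace (\<rho> v ** Y) = c1 * trace Y + c2 * trace (A ** Y)
        + c3 * trace (B ** Y) + c4 * trace (A ** B ** Y)"
      and fx: "\<forall>x \<in> carrier G. f (x \<otimes> v) = c1 * f x + c2 * f (x \<otimes> a)
        + c3 * f (x \<otimes> b) + c4 * f (x \<otimes> (a \<otimes> b))"
      using expand[OF v] by blast
    have cyc: "trace (Z ** (\<sigma> w ** \<rho> u)) = trace (\<rho> u ** (Z ** \<sigma> w))" for Z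
      by (metis trace_mul_sym matrix_mul_assoc)
    have "trace (\<rho> u ** \<rho> v ** \<sigma> w) = trace (\<rho> v ** (\<sigma> w ** \<rho> u))"
      by (metis trace_mul_sym matrix_mul_assoc)
    also have "\<dots> = c1 * trace (\<rho> u ** \<sigma> w) + c2 * trace (\<rho> u ** \<sigma> (a \<otimes> w))
      + c3 * trace (\<rho> u ** \<sigma> (b \<otimes> w)) + c4 * trace (\<rho> u ** \<sigma> (a \<otimes> b \<otimes> w))"
      unfolding tr[rule_format] unfolding cyc
      by (simp add: mult w H_closed A_def B_def trace_mul_sym[of "\<sigma> w"])
    also have "\<dots> = c1 * f (w \<otimes> u) + c2 * f (w \<otimes> u \<otimes> a) + c3 * f (w \<otimes> u \<otimes> b) + c4 * f (w \<otimes> u \<otimes> (a \<otimes> b))"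
      using u w wG ab f_commute[of "w \<otimes> u"] by (simp add: trace_mult H_closed m_assoc)
    also have "\<dots> = f (w \<otimes> (u \<otimes> v))" using fx u v wG by (simp flip: m_assoc)
    also have "\<dots> = trace (\<rho> (u \<otimes> v) ** \<sigma> w)" using u v w by (simp add: trace_mult)
    finally show "trace (\<rho> (u \<otimes> v) ** \<sigma> w) = trace (\<rho> u ** \<rho> v ** \<sigma> w)" ..
  qed
  have \<rho>_one: "\<rho> \<one> = mat 1"
    by (rule ext) (use HG in \<open>auto simp: trace_mult f\<close>)
  have \<rho>_det: "det (\<rho> u) = 1" if u: "u \<in> carrier G" for u
  proof (rule det_eq_1_if_trace_inverse)
    show "\<rho> u ** \<rho> (inv u) = mat 1" using u by (simp add: \<rho>_one flip: \<rho>_mult)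
    show "\<rho> u + \<rho> (inv u) = mat (trace (\<rho> u))"
    proof (rule ext)
      fix w assume w: "w \<in> H"
      then have "w \<in> carrier G" using HG by auto
      then show "trace ((\<rho> u + \<rho> (inv u)) ** \<sigma> w) = trace (mat (trace (\<rho> u)) ** \<sigma> w)"
        using u w f_mult_inv[of w u] \<rho>[of u]
        by (simp add: trace_add_mult trace_mult trace_mat_mult f)
    qed
  qed
  have "\<rho> \<in> hom G special_linear"
    by (rule homI) (use \<rho>_mult \<rho>_det in \<open>simp_all add: special_linear_def\<close>)
  then show ?thesis using \<rho> unfolding is_SL2_character_def by metis
qed

end

section \<open>Reduction to subgroups generated by two elements\<close>

lemma is_SL2_character_restrict:
  assumes "is_SL2_character G f" "H \<subseteq> carrier G"
  shows "is_SL2_character (G\<lparr>carrier := H\<rparr>) (restrict f H)"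
  using assms unfolding is_SL2_character_def hom_def by (fastforce simp: Pi_iff)

lemma is_SL2_character_cong:
  assumes "\<And>g. g \<in> carrier G \<Longrightarrow> f g = f' g"
  shows "is_SL2_character G f \<longleftrightarrow> is_SL2_character G f'"
  using assms unfolding is_SL2_character_def by auto

lemma trace_function_of_character:
  fixes G :: "('a, 'b) monoid_scheme" and f :: "'a \<Rightarrow> 'k::field"
  assumes "group G" "is_SL2_character G f"
  shows "trace_function G f"
proof -
  interpret group G by fact
  obtain \<rho> :: "'a \<Rightarrow> 'k ^ 2 ^ 2"
    where hom: "\<rho> \<in> hom G special_linear" and f: "\<And>g. g \<in> carrier G \<Longrightarrow> f g = trace (\<rho> g)"
    using assms(2) unfolding is_SL2_character_def by auto
  have mult: "\<rho> (g \<otimes>\<^bsub>G\<^esub> h) = \<rho> g ** \<rho> h" if "g \<in> carrier G" "h \<in> carrier G" for g h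
    using hom_mult[OF hom, of g h] that by (simp add: special_linear_def)
  have det: "det (\<rho> h) = 1" if "h \<in> carrier G" for h
    using hom_in_carrier[OF hom, of h] that by (simp add: special_linear_def)
  have one: "\<rho> \<one>\<^bsub>G\<^esub> = mat 1"
    using hom_one[OF hom assms(1) group_special_linear] by (simp add: special_linear_def)
  show ?thesis
  proof
    show "f \<one>\<^bsub>G\<^esub> = 2" by (simp add: f one trace_def mat_def)
    fix g h assume gh: "g \<in> carrier G" "h \<in> carrier G"
    have "\<rho> h ** \<rho> (inv\<^bsub>G\<^esub> h) = mat 1" using gh mult[of h "inv\<^bsub>G\<^esub> h"] one by simp
    then have "\<rho> (inv\<^bsub>G\<^esub> h) = mat (trace (\<rho> h)) - \<rho> h" by (rule inverse_SL2[OF det[OF gh(2)]])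
    moreover have "trace (\<rho> g ** \<rho> h) + trace (\<rho> g ** (mat (trace (\<rho> h)) - \<rho> h)) = trace (\<rho> g) * trace (\<rho> h)"
      by (simp add: matrix_2_simps algebra_simps)
    ultimately show "f (g \<otimes>\<^bsub>G\<^esub> h) + f (g \<otimes>\<^bsub>G\<^esub> inv\<^bsub>G\<^esub> h) = f g * f h"
      using gh by (simp add: f mult)
  qed
qed

theorem theorem1p1:
  fixes G :: "('a, 'b) monoid_scheme" and f :: "'a \<Rightarrow> 'k::field"
  assumes quadratic_roots: "\<forall>a b :: 'k. \<exists>x. x ^ 2 + a * x + b = 0"
    and "group G"
  shows "is_SL2_character G f \<longleftrightarrow>
    (\<forall>H. subgroup H G \<and> (\<exists>a \<in> carrier G. \<exists>b \<in> carrier G. H = generate G {a, b}) \<longrightarrow>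
      is_SL2_character (G\<lparr>carrier := H\<rparr>) (restrict f H))"
proof
  assume "is_SL2_character G f"
  then show "\<forall>H. subgroup H G \<and> (\<exists>a \<in> carrier G. \<exists>b \<in> carrier G. H = generate G {a, b}) \<longrightarrow>
      is_SL2_character (G\<lparr>carrier := H\<rparr>) (restrict f H)"
    by (blast intro: is_SL2_character_restrict dest: subgroup.subset)
next
  interpret group G by fact
  assume two_gen: "\<forall>H. subgroup H G \<and> (\<exists>a \<in> carrier G. \<exists>b \<in> carrier G. H = generate G {a, b}) \<longrightarrow>
      is_SL2_character (G\<lparr>carrier := H\<rparr>) (restrict f H)"
  have subgroup: "subgroup (generate G {a, b}) G" if "a \<in> carrier G" "b \<in> carrier G" for a b
    using that by (intro generate_is_subgroup) auto
  have char: "is_SL2_character (G\<lparr>carrier := generate G {a, b}\<rparr>) f"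
    if "a \<in> carrier G" "b \<in> carrier G" for a b
  proof -
    have "is_SL2_character (G\<lparr>carrier := generate G {a, b}\<rparr>) (restrict f (generate G {a, b}))"
      using two_gen subgroup that by blast
    then show ?thesis by (rule is_SL2_character_cong[THEN iffD1, rotated]) simp
  qed
  interpret trace_function G f
  proof
    fix g h assume gh: "g \<in> carrier G" "h \<in> carrier G"
    interpret H: trace_function "G\<lparr>carrier := generate G {g, h}\<rparr>" f
      using char[OF gh] subgroup[OF gh] by (intro trace_function_of_character subgroup_imp_group)
    have "g \<in> generate G {g, h}" "h \<in> generate G {g, h}" by (auto intro: generate.incl)
    then show "f (g \<otimes>\<^bsub>G\<^esub> h) + f (g \<otimes>\<^bsub>G\<^esub> inv\<^bsub>G\<^esub> h) = f g * f h"
      using H.f_mult_inv[of g h] m_inv_consistent[OF subgroup[OF gh]] by simp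
  next
    interpret H: trace_function "G\<lparr>carrier := generate G {\<one>\<^bsub>G\<^esub>, \<one>\<^bsub>G\<^esub>}\<rparr>" f
      by (intro trace_function_of_character subgroup_imp_group subgroup char one_closed)
    show "f \<one>\<^bsub>G\<^esub> = 2" using H.f_one by simp
  qed
  show "is_SL2_character G f"
  proof (cases "\<exists>a \<in> carrier G. \<exists>b \<in> carrier G. f (b \<otimes>\<^bsub>G\<^esub> a \<otimes>\<^bsub>G\<^esub> inv\<^bsub>G\<^esub> b \<otimes>\<^bsub>G\<^esub> inv\<^bsub>G\<^esub> a) \<noteq> 2")
    case True
    then show ?thesis using is_SL2_character_irreducible char by blast
  next
    case False
    then show ?thesis by (intro is_SL2_character_reducible[OF quadratic_roots]) blast
  qed
qed

end
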